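(* Let $m\mathfrak H$ be the meta-Hahn algebra with parameters $\eta_0,\eta_1,\eta_3$. The element $$Q=\{V,Z^2+Z\}+2X^2+(2-\eta_1)Z^2+\eta_1\{X,Z\}+2\eta_3X+2(\eta_0+1)Z$$ is a Casimir element of $m\mathfrak H$, i.e. $[Q,X]=[Q,Z]=[Q,V]=0$.
   Context: $[A,B]=AB-BA$, $\{A,B\}=AB+BA$. The meta-Hahn algebra $m\mathfrak H$ with real parameters $\eta_0,\eta_1,\eta_3$ is the unital associative algebra generated by $X,Z,V$ with defining relations $$[Z,X]=Z^2+Z,\qquad [X,V]=\{V,Z\}+\eta_1X+V-\eta_1Z+\eta_0\mathcal I,\qquad [V,Z]=2X+\eta_1Z+\eta_3\mathcal I,$$ where $\mathcal I$ is the identity. *)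

theory Defs
  imports Complex_Main "HOL-Algebra.QuotRing" "HOL-Algebra.Module" "HOL-Library.Poly_Mapping"
begin

section \<open>The free unital associative real algebra on three generators\<close>

datatype gen = GX | GZ | GV

datatype word = Word (letters: "gen list")

text \<open>The free monoid on the three generators. It is written additively because the convolution
  product on \<^typ>\<open>'a \<Rightarrow>\<^sub>0 'b\<close> takes its exponents from an additive (not necessarily commutative)
  monoid; \<^typ>\<open>word \<Rightarrow>\<^sub>0 real\<close> is thus the algebra of noncommutative polynomials.\<close>

instantiation word :: monoid_add
begin

definition zero_word :: word where "0 = Word []"

definition plus_word :: "word \<Rightarrow> word \<Rightarrow> word" where "u + v = Word (letters u @ letters v)"

instance by standard (simp_all add: zero_word_def plus_word_def)

end

type_synonym ncpoly = "word \<Rightarrow>\<^sub>0 real"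

definition free_algebra :: "(real, ncpoly) module" where
  "free_algebra =
     \<lparr>carrier = UNIV, mult = (*), one = 1, zero = 0, add = (+), smult = (\<lambda>c. Poly_Mapping.map ((*) c))\<rparr>"

definition gen_poly :: "gen \<Rightarrow> ncpoly" where
  "gen_poly g = Poly_Mapping.single (Word [g]) 1"

section \<open>Commutators and anticommutators\<close>

definition commutator :: "('a, 'm) ring_scheme \<Rightarrow> 'a \<Rightarrow> 'a \<Rightarrow> 'a" where
  "commutator A a b = a \<otimes>\<^bsub>A\<^esub> b \<ominus>\<^bsub>A\<^esub> b \<otimes>\<^bsub>A\<^esub> a"

definition anticommutator :: "('a, 'm) ring_scheme \<Rightarrow> 'a \<Rightarrow> 'a \<Rightarrow> 'a" where
  "anticommutator A a b = a \<otimes>\<^bsub>A\<^esub> b \<oplus>\<^bsub>A\<^esub> b \<otimes>\<^bsub>A\<^esub> a"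

section \<open>The meta-Hahn algebra\<close>

text \<open>Left-hand side minus right-hand side of each of the three defining relations.\<close>

definition meta_Hahn_relators ::
  "(real, 'a, 'm) module_scheme \<Rightarrow> real \<Rightarrow> real \<Rightarrow> real \<Rightarrow> 'a \<Rightarrow> 'a \<Rightarrow> 'a \<Rightarrow> 'a set" where
  "meta_Hahn_relators A \<eta>0 \<eta>1 \<eta>3 X Z V =
     {commutator A Z X \<ominus>\<^bsub>A\<^esub> (Z [^]\<^bsub>A\<^esub> (2::nat) \<oplus>\<^bsub>A\<^esub> Z),
      commutator A X V \<ominus>\<^bsub>A\<^esub>
        (anticommutator A V Z \<oplus>\<^bsub>A\<^esub> \<eta>1 \<odot>\<^bsub>A\<^esub> X \<oplus>\<^bsub>A\<^esub> V \<ominus>\<^bsub>A\<^esub> \<eta>1 \<odot>\<^bsub>A\<^esub> Z \<oplus>\<^bsub>A\<^esub> \<eta>0 \<odot>\<^bsub>A\<^esub> \<one>\<^bsub>A\<^esub>),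
      commutator A V Z \<ominus>\<^bsub>A\<^esub>
        (2 \<odot>\<^bsub>A\<^esub> X \<oplus>\<^bsub>A\<^esub> \<eta>1 \<odot>\<^bsub>A\<^esub> Z \<oplus>\<^bsub>A\<^esub> \<eta>3 \<odot>\<^bsub>A\<^esub> \<one>\<^bsub>A\<^esub>)}"

text \<open>Ideals of a \<^const>\<open>ring\<close> are two-sided, and an ideal of a unital algebra is closed under
  scalar multiplication.\<close>

definition meta_Hahn_ideal :: "real \<Rightarrow> real \<Rightarrow> real \<Rightarrow> ncpoly set" where
  "meta_Hahn_ideal \<eta>0 \<eta>1 \<eta>3 =
     Idl\<^bsub>free_algebra\<^esub>
       (meta_Hahn_relators free_algebra \<eta>0 \<eta>1 \<eta>3 (gen_poly GX) (gen_poly GZ) (gen_poly GV))"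

definition meta_Hahn_algebra :: "real \<Rightarrow> real \<Rightarrow> real \<Rightarrow> (real, ncpoly set) module" where
  "meta_Hahn_algebra \<eta>0 \<eta>1 \<eta>3 =
     (let I = meta_Hahn_ideal \<eta>0 \<eta>1 \<eta>3 in
      ring.extend (free_algebra Quot I)
        (module.fields (\<lambda>c S. \<Union>p\<in>S. I +>\<^bsub>free_algebra\<^esub> (c \<odot>\<^bsub>free_algebra\<^esub> p))))"

definition meta_Hahn_gen :: "real \<Rightarrow> real \<Rightarrow> real \<Rightarrow> gen \<Rightarrow> ncpoly set" where
  "meta_Hahn_gen \<eta>0 \<eta>1 \<eta>3 g = meta_Hahn_ideal \<eta>0 \<eta>1 \<eta>3 +>\<^bsub>free_algebra\<^esub> gen_poly g"

section \<open>Basic facts\<close>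

lemma free_algebra_simps [simp]:
  "carrier free_algebra = UNIV" "x \<otimes>\<^bsub>free_algebra\<^esub> y = x * y" "\<one>\<^bsub>free_algebra\<^esub> = 1"
  "\<zero>\<^bsub>free_algebra\<^esub> = 0" "x \<oplus>\<^bsub>free_algebra\<^esub> y = x + y"
  by (simp_all add: free_algebra_def)

lemma smult_free_algebra: "c \<odot>\<^bsub>free_algebra\<^esub> p = Poly_Mapping.single 0 c * p"
  by (simp add: free_algebra_def mult_map_scale_conv_mult)

lemma ring_free_algebra: "ring free_algebra"
proof (rule ringI)
  show "abelian_group free_algebra"
  proof (rule abelian_groupI)
    fix x assume "x \<in> carrier free_algebra"
    show "\<exists>y\<in>carrier free_algebra. y \<oplus>\<^bsub>free_algebra\<^esub> x = \<zero>\<^bsub>free_algebra\<^esub>"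
      by (rule bexI [of _ "- x"]) simp_all
  qed (simp_all add: ac_simps)
  show "Group.monoid free_algebra"
    by (rule monoidI) (simp_all add: mult.assoc)
qed (simp_all add: algebra_simps)

lemma ideal_meta_Hahn_ideal: "ideal (meta_Hahn_ideal \<eta>0 \<eta>1 \<eta>3) free_algebra"
  unfolding meta_Hahn_ideal_def by (rule ring.genideal_ideal [OF ring_free_algebra]) simp

lemma meta_Hahn_algebra_simps:
  fixes \<eta>0 \<eta>1 \<eta>3
  defines "A \<equiv> meta_Hahn_algebra \<eta>0 \<eta>1 \<eta>3" and "B \<equiv> free_algebra Quot meta_Hahn_ideal \<eta>0 \<eta>1 \<eta>3"
  shows "carrier A = carrier B" "mult A = mult B" "one A = one B" "zero A = zero B" "add A = add B"
  by (simp_all add: A_def B_def meta_Hahn_algebra_def Let_def ring.extend_def)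

lemma ring_meta_Hahn_algebra: "ring (meta_Hahn_algebra \<eta>0 \<eta>1 \<eta>3)"
proof -
  let ?B = "free_algebra Quot meta_Hahn_ideal \<eta>0 \<eta>1 \<eta>3"
  interpret B: ring ?B by (rule ideal.quotient_is_ring [OF ideal_meta_Hahn_ideal])
  show ?thesis
  proof (rule ringI)
    show "abelian_group (meta_Hahn_algebra \<eta>0 \<eta>1 \<eta>3)"
    proof (rule abelian_groupI)
      fix x assume "x \<in> carrier (meta_Hahn_algebra \<eta>0 \<eta>1 \<eta>3)"
      then show "\<exists>y\<in>carrier (meta_Hahn_algebra \<eta>0 \<eta>1 \<eta>3).
          y \<oplus>\<^bsub>meta_Hahn_algebra \<eta>0 \<eta>1 \<eta>3\<^esub> x = \<zero>\<^bsub>meta_Hahn_algebra \<eta>0 \<eta>1 \<eta>3\<^esub>"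
        unfolding meta_Hahn_algebra_simps by (meson B.l_neg B.a_inv_closed)
    qed (simp_all add: meta_Hahn_algebra_simps B.a_ac)
    show "Group.monoid (meta_Hahn_algebra \<eta>0 \<eta>1 \<eta>3)"
      by (rule monoidI) (simp_all add: meta_Hahn_algebra_simps B.m_assoc)
  qed (simp_all add: meta_Hahn_algebra_simps B.l_distr B.r_distr)
qed

lemma ring_hom_meta_Hahn:
  "ring_hom_ring free_algebra (meta_Hahn_algebra \<eta>0 \<eta>1 \<eta>3)
     ((+>\<^bsub>free_algebra\<^esub>) (meta_Hahn_ideal \<eta>0 \<eta>1 \<eta>3))"
proof (rule ring_hom_ringI2 [OF ring_free_algebra ring_meta_Hahn_algebra])
  show "(+>\<^bsub>free_algebra\<^esub>) (meta_Hahn_ideal \<eta>0 \<eta>1 \<eta>3)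
      \<in> ring_hom free_algebra (meta_Hahn_algebra \<eta>0 \<eta>1 \<eta>3)"
    using ideal.rcos_ring_hom [OF ideal_meta_Hahn_ideal, of \<eta>0 \<eta>1 \<eta>3]
    by (simp add: ring_hom_def meta_Hahn_algebra_simps)
qed

lemma smult_meta_Hahn_coset:
  fixes \<eta>0 \<eta>1 \<eta>3
  defines "I \<equiv> meta_Hahn_ideal \<eta>0 \<eta>1 \<eta>3"
  shows "c \<odot>\<^bsub>meta_Hahn_algebra \<eta>0 \<eta>1 \<eta>3\<^esub> (I +>\<^bsub>free_algebra\<^esub> p)
           = I +>\<^bsub>free_algebra\<^esub> (c \<odot>\<^bsub>free_algebra\<^esub> p)"
proof -
  interpret ideal I free_algebra unfolding I_def by (rule ideal_meta_Hahn_ideal)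
  have eq: "I +>\<^bsub>free_algebra\<^esub> (c \<odot>\<^bsub>free_algebra\<^esub> q) = I +>\<^bsub>free_algebra\<^esub> (c \<odot>\<^bsub>free_algebra\<^esub> p)"
    if "q \<in> I +>\<^bsub>free_algebra\<^esub> p" for q
  proof -
    from that obtain i where i: "i \<in> I" "q = i + p" by (auto simp: a_r_coset_def')
    have "Poly_Mapping.single 0 c * i \<in> I" using I_l_closed [OF i(1), of "Poly_Mapping.single 0 c"] by simp
    then have "c \<odot>\<^bsub>free_algebra\<^esub> q \<in> I +>\<^bsub>free_algebra\<^esub> (c \<odot>\<^bsub>free_algebra\<^esub> p)"
      unfolding smult_free_algebra i by (auto simp: a_r_coset_def' distrib_left)
    then show ?thesis
      by (rule a_repr_independence' [symmetric]) simp
  qed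
  have ne: "I +>\<^bsub>free_algebra\<^esub> p \<noteq> {}" using a_rcos_self [of p] by auto
  have "c \<odot>\<^bsub>meta_Hahn_algebra \<eta>0 \<eta>1 \<eta>3\<^esub> (I +>\<^bsub>free_algebra\<^esub> p)
      = (\<Union>q\<in>I +>\<^bsub>free_algebra\<^esub> p. I +>\<^bsub>free_algebra\<^esub> (c \<odot>\<^bsub>free_algebra\<^esub> q))"
    by (simp add: meta_Hahn_algebra_def Let_def I_def ring.extend_def module.fields_def)
  also have "\<dots> = I +>\<^bsub>free_algebra\<^esub> (c \<odot>\<^bsub>free_algebra\<^esub> p)"
    by (rule SUP_eq_const [OF ne eq])
  finally show ?thesis .
qed

lemma meta_Hahn_relations:
  fixes \<eta>0 \<eta>1 \<eta>3
  defines "A \<equiv> meta_Hahn_algebra \<eta>0 \<eta>1 \<eta>3"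
    and "G \<equiv> meta_Hahn_gen \<eta>0 \<eta>1 \<eta>3"
  shows "meta_Hahn_relators A \<eta>0 \<eta>1 \<eta>3 (G GX) (G GZ) (G GV) = {\<zero>\<^bsub>A\<^esub>}"
proof -
  define h where "h = (+>\<^bsub>free_algebra\<^esub>) (meta_Hahn_ideal \<eta>0 \<eta>1 \<eta>3)"
  interpret h: ring_hom_ring free_algebra A h
    unfolding h_def A_def by (rule ring_hom_meta_Hahn)
  have G: "G g = h (gen_poly g)" for g by (simp add: G_def h_def meta_Hahn_gen_def)
  have sm: "c \<odot>\<^bsub>A\<^esub> h p = h (c \<odot>\<^bsub>free_algebra\<^esub> p)" for c p
    unfolding A_def h_def by (rule smult_meta_Hahn_coset)
  have hadd: "h p \<oplus>\<^bsub>A\<^esub> h q = h (p \<oplus>\<^bsub>free_algebra\<^esub> q)"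
    and hmul: "h p \<otimes>\<^bsub>A\<^esub> h q = h (p \<otimes>\<^bsub>free_algebra\<^esub> q)"
    and hinv: "\<ominus>\<^bsub>A\<^esub> h p = h (\<ominus>\<^bsub>free_algebra\<^esub> p)" for p q
    using h.hom_add [of p q] h.hom_mult [of p q] h.hom_a_inv [of p] by simp_all
  have hsub: "h p \<ominus>\<^bsub>A\<^esub> h q = h (p \<ominus>\<^bsub>free_algebra\<^esub> q)" for p q
    by (simp only: a_minus_def hadd hinv)
  have hpow: "h p [^]\<^bsub>A\<^esub> n = h (p [^]\<^bsub>free_algebra\<^esub> n)" for p and n :: nat
    using h.hom_nat_pow [of p n] by simp
  have hone: "\<one>\<^bsub>A\<^esub> = h \<one>\<^bsub>free_algebra\<^esub>" using h.hom_one by (rule sym)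
  let ?R = "meta_Hahn_relators free_algebra \<eta>0 \<eta>1 \<eta>3 (gen_poly GX) (gen_poly GZ) (gen_poly GV)"
  have "meta_Hahn_relators A \<eta>0 \<eta>1 \<eta>3 (G GX) (G GZ) (G GV) = h ` ?R"
    unfolding meta_Hahn_relators_def commutator_def anticommutator_def
    by (simp only: G hone hadd hmul hsub hpow sm image_insert image_empty)
  also have "\<dots> = {\<zero>\<^bsub>A\<^esub>}"
  proof -
    interpret I: ideal "meta_Hahn_ideal \<eta>0 \<eta>1 \<eta>3" free_algebra by (rule ideal_meta_Hahn_ideal)
    have "h r = \<zero>\<^bsub>A\<^esub>" if "r \<in> ?R" for r
    proof -
      have "r \<in> meta_Hahn_ideal \<eta>0 \<eta>1 \<eta>3"
        using that ring.genideal_self [OF ring_free_algebra, of ?R] unfolding meta_Hahn_ideal_def by auto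
      then show ?thesis
        unfolding h_def A_def meta_Hahn_algebra_simps
        by (simp add: FactRing_def I.a_rcos_const)
    qed
    moreover have "?R \<noteq> {}" by (simp add: meta_Hahn_relators_def)
    ultimately show ?thesis by auto
  qed
  finally show ?thesis .
qed

end

theory Submission
  imports Defs
begin

text \<open>Write \<open>W = Z\<^sup>2 + Z\<close>, \<open>T = 2X + \<eta>\<^sub>1Z + \<eta>\<^sub>3\<close> and \<open>Y = {V,Z} + \<eta>\<^sub>1X + V - \<eta>\<^sub>1Z + \<eta>\<^sub>0\<close> for the right-hand sides
  of the relations, so that \<open>[Z,X] = W\<close>, \<open>[V,Z] = T\<close> and \<open>[X,V] = Y\<close>. Expanding by the Leibniz rule,
  \<open>[Q,Z]\<close> cancels outright, \<open>[Q,X]\<close> reduces to \<open>[T,W] + 2{Z,W} + 2W\<close>, and \<open>[Q,V]\<close> reduces to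
  \<open>[[T,V],Z] - 2{Z,T} - 2T\<close>; both vanish by one more use of the relations. Carrying the relators
  along in this computation expresses each commutator, in the free algebra, as an explicit
  element of the ideal they generate.\<close>

context
  fixes e0 e1 e3 x z v w q r1 r2 r3 :: "'a::ring_1"
  assumes central: "\<And>y. y * e0 = e0 * y" "\<And>y. y * e1 = e1 * y" "\<And>y. y * e3 = e3 * y"
  defines "w \<equiv> z * z + z"
    and "q \<equiv> v * (z * z + z) + (z * z + z) * v + 2 * (x * x) + (2 - e1) * (z * z)
           + e1 * (x * z + z * x) + 2 * e3 * x + 2 * (e0 + 1) * z"
    and "r1 \<equiv> z * x - x * z - (z * z + z)"
    and "r2 \<equiv> x * v - v * x - (v * z + z * v + e1 * x + v - e1 * z + e0)"
    and "r3 \<equiv> v * z - z * v - (2 * x + e1 * z + e3)"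
begin

lemma central_left_commute:
  "y * (e0 * y') = e0 * (y * y')" "y * (e1 * y') = e1 * (y * y')" "y * (e3 * y') = e3 * (y * y')"
  by (metis central mult.assoc)+

text \<open>Used uninstantiated, \<open>central\<close> would swap two scalars back and forth. These
  instances terminate: scalars move left past \<open>x\<close>, \<open>z\<close>, \<open>v\<close>
  and settle in the order \<open>e0\<close>, \<open>e1\<close>, \<open>e3\<close>.\<close>

lemmas scalars_to_front =
  central[of x] central[of z] central[of v] central(1)[of e1] central(1)[of e3] central(2)[of e3]
  central_left_commute[of x] central_left_commute[of z] central_left_commute[of v]
  central_left_commute(1)[of e1] central_left_commute(1)[of e3] central_left_commute(2)[of e3]

text \<open>Substitute [v,z] = T + r1' with r1' = \<open>r3\<close>, and [z,x] = w + r1, in the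
  Leibniz expansion; the rest cancels since {T,w} = 2{x,w} + e1{z,w} + 2 e3 w.\<close>

lemma casimir_commutator_Z:
  "q * z - z * q = (r3 * w + w * r3) - 2 * (x * r1 + r1 * x) - e1 * (r1 * z + z * r1) - 2 * e3 * r1"
  unfolding q_def w_def r1_def r3_def
  by (simp add: algebra_simps scalars_to_front mult_2 mult_2_right)

text \<open>As w commutes with z, {v,{z,w}} - {w,{v,z}} = [[v,z],w] = [T + r3, w], the source of the
  \<open>r3\<close> terms. The relator part of [T,w] = 2[x,w] cancels the 2{z,r1} + 2 r1 coming from
  2z^2 and 2z in \<open>q\<close>.\<close>

lemma casimir_commutator_X:
  "q * x - x * q = v * (z * r1 + r1 * z + r1) + (z * r1 + r1 * z + r1) * v - (r2 * w + w * r2)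
     + (r3 * w - w * r3) + e1 * (x * r1 + r1 * x) - e1 * (z * r1 + r1 * z) + 2 * e0 * r1"
  unfolding q_def w_def r1_def r2_def r3_def
  by (simp add: algebra_simps scalars_to_front mult_2 mult_2_right)

text \<open>The double commutator arises from {T,{v,z}} - {v,{T,z}} = [[T,v],z]. Since [T,v] =
  2[x,v] + e1[z,v], it contributes the summands 2[r2,z] and -e1[r3,z].\<close>

lemma casimir_commutator_V:
  "q * v - v * q = 2 * (x * r2 + r2 * x) + e1 * (z * r2 + r2 * z) + 2 * e3 * r2
     + 2 * (r2 * z - z * r2) - v * (z * r3 + r3 * z + r3) - (z * r3 + r3 * z + r3) * v
     + e1 * (z * r3 + r3 * z) - e1 * (x * r3 + r3 * x) - e1 * (r3 * z - z * r3) - 2 * e0 * r3"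
  unfolding q_def r2_def r3_def
  by (simp add: algebra_simps scalars_to_front mult_2 mult_2_right)

end

lemma a_inv_free_algebra [simp]: "\<ominus>\<^bsub>free_algebra\<^esub> p = - p"
proof -
  interpret ring free_algebra by (rule ring_free_algebra)
  show ?thesis by (rule minus_equality) simp_all
qed

lemma a_minus_free_algebra [simp]: "p \<ominus>\<^bsub>free_algebra\<^esub> q = p - q"
  by (simp add: a_minus_def)

lemma square_free_algebra [simp]: "p [^]\<^bsub>free_algebra\<^esub> (2::nat) = p * p"
  by (simp add: numeral_2_eq_2 nat_pow_def)

text \<open>The empty word is a two-sided unit and real coefficients commute, so constants are
  central although words do not commute.\<close>

lemma single_0_commute:
  fixes p :: ncpoly
  shows "p * Poly_Mapping.single 0 c = Poly_Mapping.single 0 c * p"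
proof (induction p rule: update_induct)
  case const
  then show ?case by simp
next
  case (update p a b)
  \<comment> \<open>The key \<open>a\<close> is fresh, so its old coefficient is 0 and updating
    amounts to adding a monomial.\<close>
  then have "Poly_Mapping.update a b p = Poly_Mapping.single a b + p"
    by (intro poly_mapping_eqI) (auto simp: lookup_update lookup_add lookup_single in_keys_iff)
  then show ?case
    using update by (simp add: distrib_left distrib_right mult_single mult.commute)
qed

theorem proposition2p2:
  fixes \<eta>0 \<eta>1 \<eta>3 :: real
  defines "A \<equiv> meta_Hahn_algebra \<eta>0 \<eta>1 \<eta>3"
    and "X \<equiv> meta_Hahn_gen \<eta>0 \<eta>1 \<eta>3 GX"
    and "Z \<equiv> meta_Hahn_gen \<eta>0 \<eta>1 \<eta>3 GZ"
    and "V \<equiv> meta_Hahn_gen \<eta>0 \<eta>1 \<eta>3 GV"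
  defines "Q \<equiv> anticommutator A V (Z [^]\<^bsub>A\<^esub> (2::nat) \<oplus>\<^bsub>A\<^esub> Z)
         \<oplus>\<^bsub>A\<^esub> 2 \<odot>\<^bsub>A\<^esub> (X [^]\<^bsub>A\<^esub> (2::nat))
         \<oplus>\<^bsub>A\<^esub> (2 - \<eta>1) \<odot>\<^bsub>A\<^esub> (Z [^]\<^bsub>A\<^esub> (2::nat))
         \<oplus>\<^bsub>A\<^esub> \<eta>1 \<odot>\<^bsub>A\<^esub> anticommutator A X Z
         \<oplus>\<^bsub>A\<^esub> (2 * \<eta>3) \<odot>\<^bsub>A\<^esub> X
         \<oplus>\<^bsub>A\<^esub> (2 * (\<eta>0 + 1)) \<odot>\<^bsub>A\<^esub> Z"
  shows "commutator A Q X = \<zero>\<^bsub>A\<^esub> \<and> commutator A Q Z = \<zero>\<^bsub>A\<^esub> \<and> commutator A Q V = \<zero>\<^bsub>A\<^esub>"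
proof -
  define I where "I = meta_Hahn_ideal \<eta>0 \<eta>1 \<eta>3"
  define h where "h = (+>\<^bsub>free_algebra\<^esub>) I"
  interpret I: ideal I free_algebra unfolding I_def by (rule ideal_meta_Hahn_ideal)
  interpret h: ring_hom_ring free_algebra A h
    unfolding h_def I_def A_def by (rule ring_hom_meta_Hahn)
  \<comment> \<open>Scalars become constant polynomials, which are central elements as the ring
    identities require.\<close>
  have sm: "c \<odot>\<^bsub>A\<^esub> h p = h (Poly_Mapping.single 0 c * p)" for c p
    unfolding A_def h_def I_def smult_meta_Hahn_coset smult_free_algebra ..
  have hadd: "h p \<oplus>\<^bsub>A\<^esub> h q = h (p + q)" and hmul: "h p \<otimes>\<^bsub>A\<^esub> h q = h (p * q)"
    and hinv: "\<ominus>\<^bsub>A\<^esub> h p = h (- p)" for p q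
    using h.hom_add [of p q] h.hom_mult [of p q] h.hom_a_inv [of p] by simp_all
  have hsub: "h p \<ominus>\<^bsub>A\<^esub> h q = h (p - q)" for p q
    by (simp add: a_minus_def hadd hinv)
  have hsq: "h p [^]\<^bsub>A\<^esub> (2::nat) = h (p * p)" for p
    using h.hom_nat_pow [of p 2] by simp

  define x z v where "x = gen_poly GX" and "z = gen_poly GZ" and "v = gen_poly GV"
  define e0 e1 e3 :: ncpoly where "e0 = Poly_Mapping.single 0 \<eta>0"
    and "e1 = Poly_Mapping.single 0 \<eta>1" and "e3 = Poly_Mapping.single 0 \<eta>3"
  have central: "y * e0 = e0 * y" "y * e1 = e1 * y" "y * e3 = e3 * y" for y
    unfolding e0_def e1_def e3_def by (rule single_0_commute)+
  have two: "Poly_Mapping.single 0 2 = (2 :: ncpoly)"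
    by (rule single_numeral)
  have coeffs: "Poly_Mapping.single 0 (2 - \<eta>1) = 2 - e1" "Poly_Mapping.single 0 (2 * \<eta>3) = 2 * e3"
      "Poly_Mapping.single 0 (2 * (\<eta>0 + 1)) = 2 * (e0 + 1)"
    unfolding e0_def e1_def e3_def two [symmetric] single_one [symmetric]
    by (simp_all only: single_diff single_add [symmetric] mult_single add_0_left)

  define q where "q = v * (z * z + z) + (z * z + z) * v + 2 * (x * x) + (2 - e1) * (z * z)
     + e1 * (x * z + z * x) + 2 * e3 * x + 2 * (e0 + 1) * z"
  define r1 where "r1 = z * x - x * z - (z * z + z)"
  define r2 where "r2 = x * v - v * x - (v * z + z * v + e1 * x + v - e1 * z + e0)"
  define r3 where "r3 = v * z - z * v - (2 * x + e1 * z + e3)"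
  have XZV: "X = h x" "Z = h z" "V = h v"
    by (simp_all add: X_def Z_def V_def x_def z_def v_def h_def I_def meta_Hahn_gen_def)
  have Q: "Q = h q"
    unfolding Q_def XZV anticommutator_def q_def
    by (simp only: hadd hmul hsq sm two coeffs e1_def [symmetric])

  have "{r1, r2, r3} = meta_Hahn_relators free_algebra \<eta>0 \<eta>1 \<eta>3 x z v"
    unfolding meta_Hahn_relators_def commutator_def anticommutator_def r1_def r2_def r3_def
    by (simp add: smult_free_algebra two e0_def e1_def e3_def)
  then have "{r1, r2, r3} \<subseteq> I"
    using ring.genideal_self [OF ring_free_algebra]
    unfolding I_def meta_Hahn_ideal_def x_def z_def v_def by simp
  then have r: "r1 \<in> I" "r2 \<in> I" "r3 \<in> I" by simp_all
  have add: "a + b \<in> I" if "a \<in> I" "b \<in> I" for a b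
    using additive_subgroup.a_closed [OF I.additive_subgroup_axioms that] by simp
  have left: "p * a \<in> I" and right: "a * p \<in> I" if "a \<in> I" for a p
    using I.I_l_closed [OF that, of p] I.I_r_closed [OF that, of p] by simp_all
  have diff: "a - b \<in> I" if "a \<in> I" "b \<in> I" for a b
    using add [OF that(1) left [OF that(2), of "- 1"]] by simp
  have zero: "h a = \<zero>\<^bsub>A\<^esub>" if "a \<in> I" for a
    using that by (simp add: h_def A_def meta_Hahn_algebra_simps FactRing_def I.a_rcos_const I_def [symmetric])

  \<comment> \<open>Each summand of the identity has a relator as a factor, so the closure rules for
    \<open>I\<close> settle membership term by term.\<close>
  have "q * x - x * q \<in> I"
    unfolding casimir_commutator_X [OF central, where x = x and z = z and v = v, folded q_def r1_def r2_def r3_def]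
    by (simp only: add diff left right r)
  moreover have "q * z - z * q \<in> I"
    unfolding casimir_commutator_Z [OF central, where x = x and z = z and v = v, folded q_def r1_def r3_def]
    by (simp only: add diff left right r)
  moreover have "q * v - v * q \<in> I"
    unfolding casimir_commutator_V [OF central, where x = x and z = z and v = v, folded q_def r2_def r3_def]
    by (simp only: add diff left right r)
  ultimately show ?thesis
    by (simp add: commutator_def Q XZV hmul hsub zero)
qed

end
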